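(* Let $\mathcal{D}$ be a normal and neutral domain, let $m$ be the number of alternatives, and let $0\le\varepsilon_v<1$ satisfy $\mathrm{res}_{\mathcal{D}}(m)>\varepsilon_v$. Put $m(\varepsilon_v)=\min\{\ell\in\mathbb{N}:\mathrm{res}_{\mathcal{D}}(\ell)>\varepsilon_v\}$. Then for every $0<\delta<1/2$ there exists an $(\varepsilon_v,0,\delta,\mathcal{D})$-Arbitrary Outliers vs Random Profile Tester with sample complexity $$O\left(\frac{m(\varepsilon_v)!\;m(\varepsilon_v)^2\,\log^2 m(\varepsilon_v)}{\left(1-\varepsilon_v/\mathrm{res}_{\mathcal{D}}(m(\varepsilon_v))\right)^2}\ln\frac{1}{\delta}\right).$$
   Context: Profiles and domains. Let $\mathcal{A}$ be a finite set of $m$ alternatives and $\mathcal{L}(\mathcal{A})$ the set of linear orders (preferences) over $\mathcal{A}$; for $\mathcal{X}\subseteq\mathcal{A}$, $\succ(\mathcal{X})$ is the restriction of $\succ$ to $\mathcal{X}$. A profile is a tuple $(\succ_i)_{i\in[n]}$ of $n$ preferences over $\mathcal{A}$, one per agent. A domain $\mathcal{D}$ is a collection of subsets of $\bigcup_{|\mathcal{A}|>0}\mathcal{L}(\mathcal{A})$; a profile $\mathcal{P}$ of $n$ preferences belongs to $\mathcal{D}$ (written $\mathcal{P}\in\mathcal{D}$) if there is $\mathcal{B}\in\mathcal{D}$ with $\mathcal{P}\in\mathcal{B}^n$. $\mathcal{D}$ is neutral if membership of profiles in $\mathcal{D}$ is preserved under renaming the alternatives by any permutation (the same for all preferences of the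 profile). $\mathcal{D}$ is normal if $(\succ_i)_{i\in[n]}\in\mathcal{D}$ implies $(\succ_i(\mathcal{X}))_{i\in[n]}\in\mathcal{D}$ for every $\mathcal{X}\subseteq\mathcal{A}$. The content of $\mathcal{D}$ is the function $\mathrm{con}_{\mathcal{D}}:\mathbb{N}\to[0,1]$ such that $\mathrm{con}_{\mathcal{D}}(m)\,m!$ is the maximum number of distinct preferences in a profile over $m$ alternatives belonging to $\mathcal{D}$ (with $\mathrm{con}_{\mathcal{D}}(1)=1$); the residue is $\mathrm{res}_{\mathcal{D}}(m)=1-\mathrm{con}_{\mathcal{D}}(m)$. Sampling model. An oracle, when queried, returns an agent picked uniformly at random with replacement from the set of all $n$ agents. The algorithm may then ask this agent arbitrarily many comparison queries: given two alternatives $x,y$, the agent replies which of the two it prefers. The sample complexity of an algorithm is the total number of comparison queries it makes. Problem. An $(\varepsilon_v,0,\delta,\mathcal{D})$-Arbitrary Outliers vs Random Profile Tester is a (randomized) algorithm in this model which, given a profile $(\succ_i)_{i\in[n]}$ over $\mathcal{A}$ that is of one of the following two kinds, outputs $1$ if it is of kind (i) and $0$ if it is of kind (ii), with error probability at most $\delta$: (i) there exists $\mathcal{W}\subseteq[n]$ with $|\mathcal{W}|\ge(1-\varepsilon_v)n$ such that $(\succ_i)_{i\in\mathcal{W}}\in\mathcal{D}$; (ii) for every $i\in[n]$, $\succ_i$ is distributed (independently) uniformly in $\mathcal{L}(\mathcal{A})$. The error probability is over the randomness generating the instance in (ii) and the randomness of the algorithm (including the oracle).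
   Formalization: The formal theorem requires the number n of agents to be at least the stated sample-complexity bound (with the same constant); for very small n, e.g. n = 1 with a domain containing every single preference, no tester can exist. *)

theory Defs
  imports "HOL-Probability.Probability" "HOL-Library.Infinite_Typeclass"
begin

section \<open>Preferences, profiles and domains\<close>

text \<open>
  A preference over \<open>A\<close> is a reflexive linear order on \<open>A\<close>; \<open>(x, y) \<in> r\<close> with \<open>x \<noteq> y\<close> means that
  \<open>x\<close> is preferred to \<open>y\<close>. Its restriction to \<open>X\<close> is \<^term>\<open>Restr r X\<close>.
\<close>

definition prefs :: "'a set \<Rightarrow> 'a rel set" where
  "prefs A = {r. linear_order_on A r}"

text \<open>
  A profile with agents \<open>I\<close> is a function whose values outside \<open>I\<close> are irrelevant;
  the agents \<open>[n]\<close> are represented by \<^term>\<open>{..<n::nat}\<close>.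
\<close>

definition profile :: "'a set \<Rightarrow> nat set \<Rightarrow> (nat \<Rightarrow> 'a rel) \<Rightarrow> bool" where
  "profile A I P \<longleftrightarrow> (\<forall>i\<in>I. P i \<in> prefs A)"

definition is_domain :: "'a rel set set \<Rightarrow> bool" where
  "is_domain D \<longleftrightarrow> (\<forall>B\<in>D. B \<subseteq> (\<Union>A\<in>{A. finite A \<and> A \<noteq> {}}. prefs A))"

definition belongs :: "'a rel set set \<Rightarrow> nat set \<Rightarrow> (nat \<Rightarrow> 'a rel) \<Rightarrow> bool" where
  "belongs D I P \<longleftrightarrow> (\<exists>B\<in>D. \<forall>i\<in>I. P i \<in> B)"

definition neutral :: "'a rel set set \<Rightarrow> bool" where
  "neutral D \<longleftrightarrow>
     (\<forall>A n P \<pi>. finite A \<and> A \<noteq> {} \<and> profile A {..<n} P \<and> belongs D {..<n} P \<and> \<pi> permutes A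
        \<longrightarrow> belongs D {..<n} (\<lambda>i. map_prod \<pi> \<pi> ` P i))"

text \<open>The empty set of alternatives is excluded: no domain contains the empty order.\<close>

definition normal :: "'a rel set set \<Rightarrow> bool" where
  "normal D \<longleftrightarrow>
     (\<forall>A n P X. finite A \<and> A \<noteq> {} \<and> profile A {..<n} P \<and> belongs D {..<n} P \<and> X \<subseteq> A \<and> X \<noteq> {}
        \<longrightarrow> belongs D {..<n} (\<lambda>i. Restr (P i) X))"

text \<open>
  The set below is bounded by \<open>m!\<close>, so its supremum is a maximum; it is \<open>0\<close> if there is
  no such profile.
\<close>

definition max_distinct :: "'a rel set set \<Rightarrow> nat \<Rightarrow> nat" where
  "max_distinct D m =
     Sup {card (P ` {..<n}) | A n P. finite A \<and> card A = m \<and> profile A {..<n} P \<and> belongs D {..<n} P}"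

definition content :: "'a rel set set \<Rightarrow> nat \<Rightarrow> real" where
  "content D m = (if m = 1 then 1 else real (max_distinct D m) / fact m)"

definition residue :: "'a rel set set \<Rightarrow> nat \<Rightarrow> real" where
  "residue D m = 1 - content D m"

definition min_alternatives :: "'a rel set set \<Rightarrow> real \<Rightarrow> nat" where
  "min_alternatives D \<epsilon> = (LEAST l. 1 \<le> l \<and> residue D l > \<epsilon>)"

section \<open>Sampling algorithms\<close>

text \<open>
  An interview is an adaptive sequence of comparison queries to one agent; the answer to
  \<open>Ask x y\<close> is whether the agent prefers \<open>x\<close> to \<open>y\<close>.
\<close>

datatype ('a, 'r) interview =
    Stop 'r
  | Ask 'a 'a "bool \<Rightarrow> ('a, 'r) interview"

primrec conduct :: "'a rel \<Rightarrow> ('a, 'r) interview \<Rightarrow> 'r" where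
  "conduct r (Stop c) = c"
| "conduct r (Ask x y k) = conduct r (k (x \<noteq> y \<and> (x, y) \<in> r))"

text \<open>
  Worst-case number of queries of an interview whose result \<open>c\<close> is the cost of what follows it.
\<close>

primrec interview_cost :: "('a, enat) interview \<Rightarrow> enat" where
  "interview_cost (Stop c) = c"
| "interview_cost (Ask x y k) = 1 + max (interview_cost (k True)) (interview_cost (k False))"

text \<open>
  \<open>Flip p k\<close> is internal randomness. \<open>Sample I\<close> queries the oracle, interviews the agent it
  returns, and continues with the algorithm in which the interview ends.
\<close>

datatype 'a algorithm =
    Output bool
  | Flip "nat pmf" "nat \<Rightarrow> 'a algorithm"
  | Sample "('a, 'a algorithm) interview"

primrec run :: "nat \<Rightarrow> (nat \<Rightarrow> 'a rel) \<Rightarrow> 'a algorithm \<Rightarrow> bool pmf" where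
  "run n P (Output b) = return_pmf b"
| "run n P (Flip p k) = bind_pmf p (\<lambda>c. run n P (k c))"
| "run n P (Sample I) =
     bind_pmf (pmf_of_set {..<n}) (\<lambda>i. conduct (P i) (map_interview (\<lambda>x. x) (run n P) I))"

text \<open>Total number of comparison queries, in the worst case over all runs.\<close>

primrec sample_complexity :: "'a algorithm \<Rightarrow> enat" where
  "sample_complexity (Output b) = 0"
| "sample_complexity (Flip p k) = (SUP c\<in>set_pmf p. sample_complexity (k c))"
| "sample_complexity (Sample I) = interview_cost (map_interview (\<lambda>x. x) sample_complexity I)"

section \<open>The testing problem\<close>

definition has_outliers_at_most :: "real \<Rightarrow> 'a rel set set \<Rightarrow> nat \<Rightarrow> (nat \<Rightarrow> 'a rel) \<Rightarrow> bool" where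
  "has_outliers_at_most \<epsilon> D n P \<longleftrightarrow>
     (\<exists>W \<subseteq> {..<n}. real (card W) \<ge> (1 - \<epsilon>) * real n \<and> belongs D W P)"

definition random_profile :: "'a set \<Rightarrow> nat \<Rightarrow> (nat \<Rightarrow> 'a rel) pmf" where
  "random_profile A n = Pi_pmf {..<n} {} (\<lambda>_. pmf_of_set (prefs A))"

text \<open>
  \<open>outliers_vs_random_tester \<epsilon> \<delta> D A n t\<close>: on profiles of \<open>n\<close> agents over \<open>A\<close>, the algorithm \<open>t\<close>
  errs with probability at most \<open>\<delta>\<close>. All alternatives are kept, i.e. outliers are
  agents only. For small \<open>n\<close> no tester need exist: both kinds are given by the same \<open>n\<close> agents, and
  for \<open>n = 1\<close> every profile may be of the first kind. A statement about testers therefore has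
  to require \<open>n\<close> to be large enough.
\<close>

definition outliers_vs_random_tester ::
    "real \<Rightarrow> real \<Rightarrow> 'a rel set set \<Rightarrow> 'a set \<Rightarrow> nat \<Rightarrow> 'a algorithm \<Rightarrow> bool" where
  "outliers_vs_random_tester \<epsilon> \<delta> D A n t \<longleftrightarrow>
     (\<forall>P. profile A {..<n} P \<and> has_outliers_at_most \<epsilon> D n P \<longrightarrow> pmf (run n P t) False \<le> \<delta>) \<and>
     pmf (bind_pmf (random_profile A n) (\<lambda>P. run n P t)) True \<le> \<delta>"

end

theory Submission
  imports Defs
begin

text \<open>
  Fix a set \<open>X\<close> of \<open>l = m(\<epsilon>)\<close> alternatives, let \<open>L = l!\<close>, \<open>\<rho> = res(l) = k / L\<close> and
  \<open>\<gamma> = 1 - \<epsilon> / \<rho>\<close>, and learn the restriction to \<open>X\<close> of the order of each of \<open>s\<close> sampled agents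
  by binary insertion sort. If all but an \<open>\<epsilon>\<close>-fraction of the agents lie in \<open>D\<close>, then some class of
  \<open>k\<close> orders on \<open>X\<close> contains only outliers, hence has mass at most \<open>\<epsilon> = \<rho> (1 - \<gamma>)\<close>, while in a random
  profile each such class has expected mass \<open>\<rho>\<close>. The threshold \<open>\<rho> (1 - \<gamma> / 2)\<close> separates the two
  cases by a Chernoff bound with exponent \<open>s \<rho> \<gamma>\<^sup>2 / 32\<close>. The union bound over at most \<open>L ^ k\<close> classes
  is affordable for \<open>s\<close> of order \<open>L (ln L + ln (1 / \<delta>)) / \<gamma>\<^sup>2\<close>, since \<open>\<rho> = k / L\<close>. Agents may be
  sampled repeatedly, so in the random case the samples are not independent; but the exponential
  moment given the profile is at most a product over the agents, so one moment bound covers both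
  sources of randomness as soon as \<open>n \<ge> s\<close>.
\<close>

subsection \<open>Sorting by comparison queries\<close>

text \<open>Binary search in continuation-passing style: \<open>k\<close> receives the list with
  \<open>x\<close> inserted. The fuel \<open>d\<close> makes the recursion primitive and bounds the
  number of questions. Running out of fuel is harmless only when \<open>ys\<close> is empty, which
  \<open>length ys < 2 ^ d\<close> ensures.\<close>

primrec ask_insert ::
    "nat \<Rightarrow> 'a \<Rightarrow> 'a list \<Rightarrow> ('a list \<Rightarrow> ('a, 'r) interview) \<Rightarrow> ('a, 'r) interview" where
  "ask_insert 0 x ys k = k (x # ys)"
| "ask_insert (Suc d) x ys k =
     (case drop (length ys div 2) ys of
        [] \<Rightarrow> k [x]
      | y # zs \<Rightarrow> Ask x y (\<lambda>b.
          if b then ask_insert d x (take (length ys div 2) ys) (\<lambda>us. k (us @ y # zs))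
          else ask_insert d x zs (\<lambda>us. k (take (length ys div 2) ys @ y # us))))"

primrec ask_sort ::
    "nat \<Rightarrow> 'a list \<Rightarrow> ('a list \<Rightarrow> ('a, 'r) interview) \<Rightarrow> ('a, 'r) interview" where
  "ask_sort d [] k = k []"
| "ask_sort d (x # xs) k = ask_sort d xs (\<lambda>ys. ask_insert d x ys k)"

text \<open>Both \<open>run\<close> and \<open>sample_complexity\<close> reach the end of an
  interview through \<open>map_interview\<close>. The questions do not depend on the continuation,
  so the map can be pushed into it.\<close>

lemma map_interview_ask_insert:
  "map_interview (\<lambda>x. x) f (ask_insert d x ys k) =
    ask_insert d x ys (\<lambda>us. map_interview (\<lambda>x. x) f (k us))"
  by (induction d arbitrary: ys k) (auto split: list.split simp: fun_eq_iff)

lemma map_interview_ask_sort: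
  "map_interview (\<lambda>x. x) f (ask_sort d xs k) = ask_sort d xs (\<lambda>ys. map_interview (\<lambda>x. x) f (k ys))"
  by (induction xs arbitrary: k) (simp_all add: map_interview_ask_insert)

lemma interview_cost_ask_insert:
  assumes "\<And>us. interview_cost (k us) \<le> c"
  shows "interview_cost (ask_insert d x ys k) \<le> c + enat d"
  using assms
proof (induction d arbitrary: ys k)
  case 0
  then show ?case by (simp add: zero_enat_def[symmetric])
next
  case (Suc d)
  show ?case
  proof (cases "drop (length ys div 2) ys")
    case Nil
    then have "interview_cost (ask_insert (Suc d) x ys k) \<le> c"
      using Suc.prems[of "[x]"] by (simp del: drop_eq_Nil)
    then show ?thesis
      by (rule order_trans) simp
  next
    case (Cons y zs)
    let ?I = "ask_insert d x (take (length ys div 2) ys) (\<lambda>us. k (us @ y # zs))"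
    let ?J = "ask_insert d x zs (\<lambda>us. k (take (length ys div 2) ys @ y # us))"
    have "interview_cost ?I \<le> c + enat d" "interview_cost ?J \<le> c + enat d"
      by (rule Suc.IH, rule Suc.prems)+
    then have "1 + max (interview_cost ?I) (interview_cost ?J) \<le> 1 + (c + enat d)"
      by (intro add_left_mono) simp
    also have "\<dots> = c + enat (Suc d)"
      by (cases c) (simp_all add: one_enat_def)
    finally show ?thesis using Cons by simp
  qed
qed

lemma interview_cost_ask_sort:
  assumes "\<And>ys. interview_cost (k ys) \<le> c"
  shows "interview_cost (ask_sort d xs k) \<le> c + enat (length xs * d)"
  using assms
proof (induction xs arbitrary: k c)
  case Nil
  then show ?case by (simp add: zero_enat_def[symmetric])
next
  case (Cons x xs)
  have "interview_cost (ask_sort d (x # xs) k) \<le> (c + enat d) + enat (length xs * d)"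
    using Cons.IH[of "\<lambda>ys. ask_insert d x ys k" "c + enat d"]
      interview_cost_ask_insert[OF Cons.prems] by simp
  also have "\<dots> = c + enat (length (x # xs) * d)"
    by (simp add: add.assoc)
  finally show ?case .
qed

text \<open>By transitivity, one comparison with the middle element places \<open>x\<close> relative
  to a whole half of the list, and the search continues in the other half.\<close>

lemma conduct_ask_insert:
  assumes "linear_order_on A r" "x \<in> A" "set ys \<subseteq> A" "x \<notin> set ys" "distinct ys"
    and "sorted_wrt (\<lambda>a b. (a, b) \<in> r) ys" "length ys < 2 ^ d"
  shows "\<exists>us. set us = insert x (set ys) \<and> distinct us \<and> sorted_wrt (\<lambda>a b. (a, b) \<in> r) us \<and>
    conduct r (ask_insert d x ys k) = conduct r (k us)"
  using assms(3-)
proof (induction d arbitrary: ys k)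
  case 0
  then show ?case by (intro exI[of _ "[x]"]) simp
next
  case (Suc d)
  have tr: "(a, c) \<in> r" if "(a, b) \<in> r" "(b, c) \<in> r" for a b c
    using that assms(1) unfolding order_on_defs by (meson transD)
  have tot: "(x, y) \<in> r \<or> (y, x) \<in> r" if "y \<in> A" "x \<noteq> y" for y
    using that assms(1,2) unfolding order_on_defs total_on_def by blast
  show ?case
  proof (cases "drop (length ys div 2) ys")
    case Nil
    then have "ys = []" by (cases ys) auto
    then show ?thesis by (intro exI[of _ "[x]"]) simp
  next
    case (Cons y zs)
    define ws where "ws = take (length ys div 2) ys"
    have ys: "ys = ws @ y # zs"
      unfolding ws_def using Cons by (metis append_take_drop_id)
    have len: "length ws = length ys div 2" by (simp add: ws_def)
    have "length ys = length ws + Suc (length zs)" using arg_cong[OF ys, of length] by simp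
    \<comment> \<open>Removing the middle element leaves two parts of length at most
      \<open>length ys div 2\<close>, which is below \<open>2 ^ d\<close>.\<close>
    with len Suc.prems(5) have lens: "length ws < 2 ^ d" "length zs < 2 ^ d" by auto
    have step: "ask_insert (Suc d) x ys k = Ask x y (\<lambda>b.
        if b then ask_insert d x ws (\<lambda>us. k (us @ y # zs))
        else ask_insert d x zs (\<lambda>us. k (ws @ y # us)))"
      unfolding ws_def using Cons by simp
    have prems: "x \<noteq> y" "y \<in> A" "set ws \<subseteq> A" "set zs \<subseteq> A" "x \<notin> set ws" "x \<notin> set zs"
      "distinct (ws @ y # zs)" "sorted_wrt (\<lambda>a b. (a, b) \<in> r) (ws @ y # zs)"
      using Suc.prems(1-4) unfolding ys by auto
    show ?thesis
    proof (cases "(x, y) \<in> r")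
      case True
      obtain us where us: "set us = insert x (set ws)" "distinct us"
        "sorted_wrt (\<lambda>a b. (a, b) \<in> r) us"
        "conduct r (ask_insert d x ws (\<lambda>us. k (us @ y # zs))) = conduct r (k (us @ y # zs))"
        using Suc.IH[of ws "\<lambda>us. k (us @ y # zs)"] prems lens(1)
        by (auto simp: sorted_wrt_append)
      show ?thesis
      proof (intro exI[of _ "us @ y # zs"] conjI)
        show "conduct r (ask_insert (Suc d) x ys k) = conduct r (k (us @ y # zs))"
          unfolding step using True us(4) prems(1) by simp
        show "sorted_wrt (\<lambda>a b. (a, b) \<in> r) (us @ y # zs)"
          using prems(8) us(1,3) True tr by (auto simp: sorted_wrt_append)
      qed (use prems us(1,2) in \<open>auto simp: ys\<close>)
    next
      case False
      then have yx: "(y, x) \<in> r" using tot prems(1,2) by blast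
      obtain us where us: "set us = insert x (set zs)" "distinct us"
        "sorted_wrt (\<lambda>a b. (a, b) \<in> r) us"
        "conduct r (ask_insert d x zs (\<lambda>us. k (ws @ y # us))) = conduct r (k (ws @ y # us))"
        using Suc.IH[of zs "\<lambda>us. k (ws @ y # us)"] prems lens(2)
        by (auto simp: sorted_wrt_append)
      show ?thesis
      proof (intro exI[of _ "ws @ y # us"] conjI)
        show "conduct r (ask_insert (Suc d) x ys k) = conduct r (k (ws @ y # us))"
          unfolding step using False us(4) by simp
        show "sorted_wrt (\<lambda>a b. (a, b) \<in> r) (ws @ y # us)"
          using prems(8) us(1,3) yx tr by (auto simp: sorted_wrt_append)
      qed (use prems us(1,2) in \<open>auto simp: ys\<close>)
    qed
  qed
qed

lemma conduct_ask_sort: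
  assumes "linear_order_on A r" "set xs \<subseteq> A" "distinct xs" "length xs \<le> 2 ^ d"
  shows "\<exists>ys. set ys = set xs \<and> distinct ys \<and> sorted_wrt (\<lambda>a b. (a, b) \<in> r) ys \<and>
    conduct r (ask_sort d xs k) = conduct r (k ys)"
  using assms(2-)
proof (induction xs arbitrary: k)
  case Nil
  then show ?case by simp
next
  case (Cons x xs)
  obtain ys where ys: "set ys = set xs" "distinct ys" "sorted_wrt (\<lambda>a b. (a, b) \<in> r) ys"
    "conduct r (ask_sort d xs (\<lambda>ys. ask_insert d x ys k)) = conduct r (ask_insert d x ys k)"
    using Cons.IH[of "\<lambda>ys. ask_insert d x ys k"] Cons.prems by auto
  \<comment> \<open>The sorted tail is strictly shorter than \<open>x # xs\<close>, so the weak
    bound on the input becomes the strict bound that insertion requires.\<close>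
  have "length ys = length xs"
    using ys Cons.prems by (metis distinct.simps(2) distinct_card)
  then show ?case
    using conduct_ask_insert[OF assms(1), of x ys d k] Cons.prems ys by auto
qed

section \<open>Reading off the restricted order from a sorted list\<close>

primrec order_of_list :: "'a list \<Rightarrow> 'a rel" where
  "order_of_list [] = {}"
| "order_of_list (x # xs) = {x} \<times> set (x # xs) \<union> order_of_list xs"

text \<open>Antisymmetry rules out pairs pointing backwards in a sorted list of distinct elements.
  So the list determines the restriction, and an interview reveals exactly the order of the agent on
  the chosen alternatives.\<close>

lemma order_of_list_eq_Restr:
  assumes "linear_order_on A r" "set ys \<subseteq> A" "distinct ys" "sorted_wrt (\<lambda>a b. (a, b) \<in> r) ys"
  shows "order_of_list ys = Restr r (set ys)"
  using assms(2-)
proof (induction ys)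
  case Nil
  then show ?case by simp
next
  case (Cons y ys)
  have "(y, y) \<in> r"
    using assms(1) Cons.prems unfolding order_on_defs refl_on_def by auto
  moreover have "(z, y) \<notin> r" if "z \<in> set ys" for z
  proof
    assume "(z, y) \<in> r"
    moreover have "(y, z) \<in> r" "y \<noteq> z" using Cons.prems that by auto
    ultimately show False
      using assms(1) unfolding order_on_defs by (meson antisymD)
  qed
  ultimately show ?case
    using Cons by auto
qed

subsection \<open>Sampling and tallying\<close>

text \<open>The newest sample comes first in the accumulator; the decision rule used below only
  counts entries, so their order is immaterial.\<close>

primrec sampler ::
    "('a rel list \<Rightarrow> bool) \<Rightarrow> nat \<Rightarrow> 'a list \<Rightarrow> nat \<Rightarrow> 'a rel list \<Rightarrow> 'a algorithm" where
  "sampler f d xs 0 rs = Output (f rs)"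
| "sampler f d xs (Suc s) rs =
     Sample (ask_sort d xs (\<lambda>ys. Stop (sampler f d xs s (order_of_list ys # rs))))"

lemma sample_complexity_sampler:
  "sample_complexity (sampler f d xs s rs) \<le> enat (s * (length xs * d))"
proof (induction s arbitrary: rs)
  case 0
  then show ?case by simp
next
  case (Suc s)
  have "sample_complexity (sampler f d xs (Suc s) rs)
    \<le> enat (s * (length xs * d)) + enat (length xs * d)"
    by (simp add: map_interview_ask_sort del: plus_enat_simps)
      (rule interview_cost_ask_sort, simp add: Suc)
  then show ?case by (simp add: algebra_simps)
qed

text \<open>As sorting recovers the restricted order without error, one round amounts to drawing a
  uniform agent and recording its restriction.\<close>

lemma run_sampler_Suc:
  assumes "profile A {..<n} P" "n > 0" "set xs \<subseteq> A" "distinct xs" "length xs \<le> 2 ^ d"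
  shows "run n P (sampler f d xs (Suc s) rs) =
    pmf_of_set {..<n} \<bind> (\<lambda>i. run n P (sampler f d xs s (Restr (P i) (set xs) # rs)))"
proof -
  have "conduct (P i) (ask_sort d xs (\<lambda>ys. Stop (run n P (sampler f d xs s (order_of_list ys # rs)))))
    = run n P (sampler f d xs s (Restr (P i) (set xs) # rs))" if "i < n" for i
  proof -
    have lin: "linear_order_on A (P i)"
      using assms(1) that by (auto simp: profile_def prefs_def)
    show ?thesis
      using conduct_ask_sort[OF lin assms(3-5),
          of "\<lambda>ys. Stop (run n P (sampler f d xs s (order_of_list ys # rs)))"]
        order_of_list_eq_Restr[OF lin] assms(3) by auto
  qed
  moreover have "set_pmf (pmf_of_set {..<n}) = {..<n}"
    using assms(2) by (intro set_pmf_of_set) auto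
  ultimately show ?thesis
    unfolding sampler.simps run.simps map_interview_ask_sort interview.map
    by (intro bind_pmf_cong) auto
qed

text \<open>
  The exponential moment method for a union of events indexed by \<open>J\<close>: for a fixed profile the
  samples are independent, which turns the moment of a product of weights into a power of the average weight of an agent.
\<close>

lemma pmf_run_sampler_le:
  fixes w :: "'j \<Rightarrow> 'a rel \<Rightarrow> real"
  assumes "profile A {..<n} P" "n > 0" "set xs \<subseteq> A" "distinct xs" "length xs \<le> 2 ^ d"
    and "\<And>rs. f rs = b \<Longrightarrow> 1 \<le> (\<Sum>j\<in>J. a j * (\<Prod>r\<leftarrow>rs. w j r))"
    and nonneg: "\<And>j. j \<in> J \<Longrightarrow> 0 \<le> a j" "\<And>j r. j \<in> J \<Longrightarrow> 0 \<le> w j r"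
  shows "pmf (run n P (sampler f d xs s rs)) b
    \<le> (\<Sum>j\<in>J. a j * (\<Prod>r\<leftarrow>rs. w j r) * ((\<Sum>i<n. w j (Restr (P i) (set xs))) / real n) ^ s)"
proof (induction s arbitrary: rs)
  case 0
  have "0 \<le> (\<Prod>r\<leftarrow>rs. w j r)" if "j \<in> J" for j rs
    using nonneg(2)[OF that] by (intro prod_list_nonneg) auto
  \<comment> \<open>Nonnegativity handles the lists with \<open>f rs \<noteq> b\<close>, where the
    probability is \<open>0\<close> and the assumed lower bound says nothing.\<close>
  then have "0 \<le> (\<Sum>j\<in>J. a j * (\<Prod>r\<leftarrow>rs. w j r))"
    by (intro sum_nonneg mult_nonneg_nonneg nonneg(1))
  then show ?case
    using assms(6)[of rs] by (cases "f rs = b") simp_all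
next
  case (Suc s)
  let ?W = "\<lambda>j. (\<Sum>i<n. w j (Restr (P i) (set xs))) / real n"
  let ?R = "\<lambda>i. Restr (P i) (set xs)"
  define V where "V j = ?W j ^ s" for j
  have "pmf (run n P (sampler f d xs (Suc s) rs)) b
    = (\<Sum>i<n. pmf (run n P (sampler f d xs s (?R i # rs))) b) / real n"
    using assms(2) unfolding run_sampler_Suc[OF assms(1-5)]
    by (simp add: pmf_bind integral_pmf_of_set lessThan_empty_iff)
  also have "\<dots> \<le> (\<Sum>i<n. \<Sum>j\<in>J. a j * (\<Prod>r\<leftarrow>?R i # rs. w j r) * V j) / real n"
    unfolding V_def by (intro divide_right_mono sum_mono Suc) simp
  \<comment> \<open>After swapping the sums, only the weight of the first sample depends on
    \<open>i\<close>; its average over the agents is \<open>?W j\<close>.\<close>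
  also have "\<dots> = (\<Sum>j\<in>J. a j * (\<Prod>r\<leftarrow>rs. w j r) * V j * ?W j)"
    by (subst sum.swap) (simp add: sum_divide_distrib sum_distrib_left mult_ac)
  finally show ?case by (simp add: V_def mult_ac)
qed

subsection \<open>Linear orders and their restrictions\<close>

lemma linear_order_on_image:
  assumes "linear_order_on A r" "\<pi> permutes A"
  shows "linear_order_on A (map_prod \<pi> \<pi> ` r)"
proof -
  have inj: "\<pi> x = \<pi> y \<longleftrightarrow> x = y" for x y
    using permutes_inj[OF assms(2)] by (auto dest: injD)
  have im: "\<pi> x \<in> A \<longleftrightarrow> x \<in> A" for x
    using permutes_in_image[OF assms(2)] .
  have surj: "\<exists>x\<in>A. y = \<pi> x" if "y \<in> A" for y
    using that permutes_image[OF assms(2)] by blast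
  have mem: "(\<pi> x, \<pi> y) \<in> map_prod \<pi> \<pi> ` r \<longleftrightarrow> (x, y) \<in> r" for x y
    by (auto simp: inj)
  have r: "r \<subseteq> A \<times> A" "\<And>x. x \<in> A \<Longrightarrow> (x, x) \<in> r"
    "\<And>x y z. (x, y) \<in> r \<Longrightarrow> (y, z) \<in> r \<Longrightarrow> (x, z) \<in> r"
    "\<And>x y. (x, y) \<in> r \<Longrightarrow> (y, x) \<in> r \<Longrightarrow> x = y"
    "\<And>x y. x \<in> A \<Longrightarrow> y \<in> A \<Longrightarrow> (x, y) \<in> r \<or> (y, x) \<in> r"
    subgoal using assms(1) by (simp add: order_on_defs)
    subgoal using assms(1) by (simp add: order_on_defs refl_on_def)
    subgoal using assms(1) by (meson order_on_defs transD)
    subgoal using assms(1) by (meson order_on_defs antisymD)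
    subgoal using assms(1) by (metis order_on_defs(3) order_on_defs(1,2) refl_on_def total_on_def)
    done
  show ?thesis
    unfolding order_on_defs refl_on_def
  proof (intro conjI)
    show "map_prod \<pi> \<pi> ` r \<subseteq> A \<times> A" using r(1) im by auto
    show "\<forall>x\<in>A. (x, x) \<in> map_prod \<pi> \<pi> ` r" using surj mem r(2) by metis
    show "trans (map_prod \<pi> \<pi> ` r)"
    proof (rule transI)
      fix x y z assume "(x, y) \<in> map_prod \<pi> \<pi> ` r" "(y, z) \<in> map_prod \<pi> \<pi> ` r"
      then obtain a b c where "(a, b) \<in> r" "(b, c) \<in> r" "x = \<pi> a" "z = \<pi> c"
        by (auto simp: inj)
      then show "(x, z) \<in> map_prod \<pi> \<pi> ` r" using mem r(3) by blast
    qed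
    show "antisym (map_prod \<pi> \<pi> ` r)" by (rule antisymI) (use r(4) in \<open>auto simp: inj\<close>)
    show "total_on A (map_prod \<pi> \<pi> ` r)" unfolding total_on_def using surj mem r(5) by metis
  qed
qed

lemma linear_order_on_Restr:
  assumes "linear_order_on A r" "X \<subseteq> A"
  shows "linear_order_on X (Restr r X)"
proof -
  have "trans (Restr r X)"
    using assms(1) by (simp add: order_on_defs trans_Restr)
  moreover have "total_on X (Restr r X)"
    using total_on_subset[OF _ assms(2)] assms(1) by (auto simp: order_on_defs total_on_def)
  ultimately show ?thesis
    using assms unfolding order_on_defs refl_on_def antisym_def by auto
qed

section \<open>Renaming of orders, their number, and uniformity of restrictions\<close>

lemma finite_prefs: "finite A \<Longrightarrow> finite (prefs A)"
  by (rule finite_subset[of _ "Pow (A \<times> A)"]) (auto simp: prefs_def order_on_defs refl_on_def)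

lemma prefs_nonempty: "prefs A \<noteq> {}"
  using well_order_on[of A] by (auto simp: prefs_def well_order_on_def)

text \<open>Finiteness gives access to the theory of embeddings of well-orders.\<close>

lemma prefs_well_order_on:
  assumes "finite A" "r \<in> prefs A"
  shows "well_order_on A r"
proof -
  have "r \<subseteq> A \<times> A" and lin: "linear_order_on A r"
    using assms(2) by (auto simp: prefs_def order_on_defs)
  then have "finite r" using assms(1) finite_subset by blast
  with lin show ?thesis by (simp add: linear_order_on_well_order_on)
qed

text \<open>Two well-orders on the same finite set are isomorphic, and the isomorphism extends to a
  permutation by the identity outside \<open>A\<close>.\<close>

lemma ex_permutes_image_prefs:
  assumes "finite A" "r \<in> prefs A" "r' \<in> prefs A"
  obtains \<pi> where "\<pi> permutes A" "map_prod \<pi> \<pi> ` r = r'"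
proof -
  have wo: "well_order_on A r" "well_order_on A r'"
    using assms prefs_well_order_on by blast+
  have field: "Field r = A" "Field r' = A"
    using wo well_order_on_Well_order by blast+
  obtain f where f: "iso r r' f"
    using finite_well_order_on_ordIso[OF assms(1) wo] unfolding ordIso_def by auto
  then have bij: "bij_betw f A A"
    and iff: "\<And>a b. a \<in> A \<Longrightarrow> b \<in> A \<Longrightarrow> (a, b) \<in> r \<longleftrightarrow> (f a, f b) \<in> r'"
    unfolding iso_iff2 field by auto
  define \<pi> where "\<pi> x = (if x \<in> A then f x else x)" for x
  have "bij_betw \<pi> A A"
    using bij by (subst bij_betw_cong[where g = f]) (auto simp: \<pi>_def)
  then have perm: "\<pi> permutes A"
    by (rule bij_imp_permutes) (simp add: \<pi>_def)
  have "map_prod \<pi> \<pi> ` r = r'"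
  proof (intro equalityI subsetI)
    fix p assume "p \<in> map_prod \<pi> \<pi> ` r"
    then obtain a b where ab: "(a, b) \<in> r" "p = (\<pi> a, \<pi> b)" by auto
    then have "a \<in> A" "b \<in> A" using field(1) by (auto simp: Field_def)
    then show "p \<in> r'" using ab iff by (simp add: \<pi>_def)
  next
    fix p assume p: "p \<in> r'"
    then have "fst p \<in> A" "snd p \<in> A" using field(2) by (cases p; auto simp: Field_def)+
    then obtain a b where ab: "a \<in> A" "b \<in> A" "p = (f a, f b)"
      using bij unfolding bij_betw_def by (metis imageE prod.collapse)
    then have "(a, b) \<in> r" using p iff by simp
    then show "p \<in> map_prod \<pi> \<pi> ` r"
      using ab by (intro image_eqI[of _ _ "(a, b)"]) (auto simp: \<pi>_def)
  qed
  with perm show ?thesis by (rule that)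
qed

text \<open>Renaming a fixed order \<open>r\<close> gives a bijection from the permutations of
  \<open>A\<close> to its orders: surjective by transitivity of the action, injective because
  embeddings of well-orders are unique.\<close>

lemma card_prefs:
  assumes "finite A"
  shows "card (prefs A) = fact (card A)"
proof -
  obtain r where r: "r \<in> prefs A" using prefs_nonempty by blast
  then have wo: "well_order_on A r"
    using assms prefs_well_order_on by blast
  have field: "Field r = A" and Wo: "Well_order r"
    using wo well_order_on_Well_order by blast+
  have "bij_betw (\<lambda>\<pi>. map_prod \<pi> \<pi> ` r) {\<pi>. \<pi> permutes A} (prefs A)"
    unfolding bij_betw_def
  proof
    show "inj_on (\<lambda>\<pi>. map_prod \<pi> \<pi> ` r) {\<pi>. \<pi> permutes A}"
    proof (rule inj_onI, clarsimp)
      fix \<pi> \<rho> assume perm: "\<pi> permutes A" "\<rho> permutes A"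
        and eq: "map_prod \<pi> \<pi> ` r = map_prod \<rho> \<rho> ` r"
      have wo': "Well_order (map_prod \<pi> \<pi> ` r)" "Field (map_prod \<pi> \<pi> ` r) = A"
        using linear_order_on_image[OF _ perm(1), of r] r prefs_well_order_on[OF assms]
          well_order_on_Well_order unfolding prefs_def by blast+
      have iso: "iso r (map_prod \<sigma> \<sigma> ` r) \<sigma>"
        if "\<sigma> permutes A" "Field (map_prod \<sigma> \<sigma> ` r) = A" for \<sigma>
        unfolding iso_iff2 field that(2)
        using permutes_imp_bij[OF that(1)] permutes_inj[OF that(1)]
        by (auto dest: injD)
      have "embed r (map_prod \<pi> \<pi> ` r) \<pi>" "embed r (map_prod \<pi> \<pi> ` r) \<rho>"
        using iso[OF perm(1)] iso[OF perm(2)] eq wo'(2) by (auto simp: iso_def)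
      then have "\<pi> x = \<rho> x" if "x \<in> A" for x
        using embed_unique[OF Wo wo'(1)] that field by blast
      then show "\<pi> = \<rho>"
        using perm by (metis ext permutes_not_in)
    qed
    show "(\<lambda>\<pi>. map_prod \<pi> \<pi> ` r) ` {\<pi>. \<pi> permutes A} = prefs A"
    proof (intro equalityI subsetI)
      fix r' assume "r' \<in> prefs A"
      then obtain \<pi> where "\<pi> permutes A" "map_prod \<pi> \<pi> ` r = r'"
        using ex_permutes_image_prefs[OF assms r] by blast
      then show "r' \<in> (\<lambda>\<pi>. map_prod \<pi> \<pi> ` r) ` {\<pi>. \<pi> permutes A}" by blast
    qed (use r linear_order_on_image in \<open>auto simp: prefs_def\<close>)
  qed
  then show ?thesis
    using card_permutations[OF refl assms] by (simp add: bij_betw_same_card[symmetric])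
qed

text \<open>
  Renaming the alternatives in \<open>X\<close> acts transitively on \<^term>\<open>prefs X\<close>, so all fibres of the
  restriction map have the same size.
\<close>

lemma map_pmf_Restr_prefs:
  assumes "finite A" "X \<subseteq> A"
  shows "map_pmf (\<lambda>r. Restr r X) (pmf_of_set (prefs A)) = pmf_of_set (prefs X)"
proof -
  let ?M = "map_pmf (\<lambda>r. Restr r X) (pmf_of_set (prefs A))"
  have finX: "finite X" using assms finite_subset by blast
  have set: "set_pmf (pmf_of_set (prefs A)) = prefs A"
    using finite_prefs[OF assms(1)] prefs_nonempty by (intro set_pmf_of_set)
  have sub: "set_pmf ?M \<subseteq> prefs X"
    unfolding set_map_pmf set using linear_order_on_Restr[OF _ assms(2)] by (auto simp: prefs_def)
  \<comment> \<open>One inequality suffices, since \<open>a\<close> and \<open>b\<close> may be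
    exchanged. A permutation taking \<open>a\<close> to \<open>b\<close> sends the fibre over
    \<open>a\<close> injectively into the fibre over \<open>b\<close>.\<close>
  have le: "pmf ?M a \<le> pmf ?M b" if ab: "a \<in> prefs X" "b \<in> prefs X" for a b
  proof -
    obtain \<pi> where \<pi>: "\<pi> permutes X" "map_prod \<pi> \<pi> ` a = b"
      using ex_permutes_image_prefs[OF finX ab] by blast
    have \<pi>A: "\<pi> permutes A" using \<pi>(1) assms(2) by (rule permutes_subset)
    have inj: "inj (map_prod \<pi> \<pi>)" using permutes_inj[OF \<pi>(1)] by (intro prod.inj_map)
    have comm: "Restr (map_prod \<pi> \<pi> ` r) X = map_prod \<pi> \<pi> ` Restr r X" for r
      using permutes_in_image[OF \<pi>(1)] by auto
    have "inj_on (image (map_prod \<pi> \<pi>)) B" for B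
      using inj by (meson inj_image_eq_iff inj_onI)
    moreover have "image (map_prod \<pi> \<pi>) ` (prefs A \<inter> (\<lambda>r. Restr r X) -` {a})
      \<subseteq> prefs A \<inter> (\<lambda>r. Restr r X) -` {b}"
      using linear_order_on_image[OF _ \<pi>A] comm \<pi>(2) by (auto simp: prefs_def)
    ultimately have "card (prefs A \<inter> (\<lambda>r. Restr r X) -` {a}) \<le> card (prefs A \<inter> (\<lambda>r. Restr r X) -` {b})"
      using finite_prefs[OF assms(1)] by (intro card_inj_on_le) auto
    then show ?thesis
      using finite_prefs[OF assms(1)] prefs_nonempty[of A]
      by (simp add: pmf_map measure_pmf_of_set divide_right_mono)
  qed
  obtain a where a: "a \<in> prefs X" using prefs_nonempty by blast
  have eq: "pmf ?M b = pmf ?M a" if "b \<in> prefs X" for b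
    using le[OF a that] le[OF that a] by simp
  have "1 = (\<Sum>b\<in>prefs X. pmf ?M b)"
    using sum_pmf_eq_1[OF finite_prefs[OF finX] sub] by simp
  also have "\<dots> = real (card (prefs X)) * pmf ?M a"
    using eq by simp
  finally have a_val: "pmf ?M a = 1 / real (card (prefs X))"
    by (metis mult_zero_left nonzero_eq_divide_eq mult.commute zero_neq_one)
  show ?thesis
  proof (rule pmf_eqI)
    fix b
    show "pmf ?M b = pmf (pmf_of_set (prefs X)) b"
    proof (cases "b \<in> prefs X")
      case True
      then show ?thesis
        using eq[OF True] a_val finite_prefs[OF finX] prefs_nonempty[of X] by simp
    next
      case False
      then have "pmf ?M b = 0" using sub by (meson pmf_eq_0_set_pmf subsetD)
      then show ?thesis
        using False finite_prefs[OF finX] prefs_nonempty[of X] by simp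
    qed
  qed
qed

text \<open>Normality keeps the restricted profile of \<open>W\<close> in the domain, so it competes
  in the maximum for \<open>card X\<close> alternatives.\<close>

lemma card_restrictions_le_max_distinct:
  assumes "normal D" "finite A" "X \<subseteq> A" "X \<noteq> {}" "finite W"
    and "profile A W P" "belongs D W P"
  shows "card ((\<lambda>i. Restr (P i) X) ` W) \<le> max_distinct D (card X)"
proof -
  \<comment> \<open>The agents in \<open>W\<close> are renumbered, as \<open>normal\<close> and
    \<open>max_distinct\<close> speak of initial segments only.\<close>
  obtain f where f: "bij_betw f {..<card W} W"
    using ex_bij_betw_nat_finite[OF assms(5)] by (auto simp: atLeast0LessThan)
  let ?Q = "\<lambda>j. Restr (P (f j)) X"
  have im: "f ` {..<card W} = W" using f by (simp add: bij_betw_def)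
  have "profile A {..<card W} (P \<circ> f)" "belongs D {..<card W} (P \<circ> f)"
    using assms(6,7) im by (auto simp: profile_def belongs_def)
  moreover from this have "belongs D {..<card W} (\<lambda>j. Restr ((P \<circ> f) j) X)"
    using assms(1-4) unfolding normal_def by blast
  ultimately have "belongs D {..<card W} ?Q" "profile X {..<card W} ?Q"
    using linear_order_on_Restr[OF _ assms(3)] by (auto simp: profile_def prefs_def)
  moreover have "finite X" using assms(2,3) finite_subset by blast
  moreover have "?Q ` {..<card W} = (\<lambda>i. Restr (P i) X) ` (f ` {..<card W})"
    by (simp add: image_image)
  ultimately have mem: "card ((\<lambda>i. Restr (P i) X) ` W) \<in> {card (P ` {..<n}) | A n P.
      finite A \<and> card A = card X \<and> profile A {..<n} P \<and> belongs D {..<n} P}"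
    unfolding im by (intro CollectI exI[of _ X] exI[of _ "card W"] exI[of _ ?Q]) simp
  \<comment> \<open>On \<open>nat\<close>, \<open>Sup\<close> is known to be an upper bound only for
    bounded sets.\<close>
  have "bdd_above {card (P ` {..<n}) | A n P.
      finite A \<and> card A = card X \<and> profile A {..<n} P \<and> belongs D {..<n} P}"
  proof (rule bdd_aboveI[of _ "fact (card X)"], clarsimp)
    fix B :: "'a set" and n and Q :: "nat \<Rightarrow> 'a rel"
    assume B: "finite B" "card B = card X" "profile B {..<n} Q"
    then have "card (Q ` {..<n}) \<le> card (prefs B)"
      by (intro card_mono finite_prefs) (auto simp: profile_def)
    then show "card (Q ` {..<n}) \<le> fact (card X)"
      using card_prefs[OF B(1)] B(2) by simp
  qed
  then show ?thesis
    unfolding max_distinct_def by (rule cSup_upper[OF mem])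
qed

subsection \<open>Exponential moments\<close>

text \<open>Multiplied by \<open>1 + x\<close>, the left side is at most \<open>1\<close>, while the
  right side becomes \<open>1 + x ^ 3\<close>.\<close>

lemma exp_minus_le_quadratic:
  fixes x :: real
  assumes "0 \<le> x"
  shows "exp (- x) \<le> 1 - x + x\<^sup>2"
proof -
  have "exp (- x) * (1 + x) \<le> exp (- x) * exp x"
    by (intro mult_left_mono) auto
  also have "\<dots> = 1" by (simp add: exp_minus)
  also have "1 \<le> (1 - x + x\<^sup>2) * (1 + x)"
    using assms by (simp add: algebra_simps power2_eq_square)
  finally show ?thesis
    using assms by (simp add: mult_le_cancel_right)
qed

lemma prod_list_exp_of_bool:
  "(\<Prod>r\<leftarrow>rs. exp (c * of_bool (Q r))) = exp (c * real (length (filter Q rs)))"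
  by (induction rs) (auto simp: exp_add[symmetric] algebra_simps)

lemma sum_exp_of_bool:
  fixes c :: real
  assumes "finite I"
  shows "(\<Sum>i\<in>I. exp (c * of_bool (Q i))) = real (card I) + (exp c - 1) * real (card {i \<in> I. Q i})"
  using assms
proof (induction I)
  case empty
  then show ?case by simp
next
  case (insert x I)
  have "{i \<in> insert x I. Q i} = (if Q x then insert x {i \<in> I. Q i} else {i \<in> I. Q i})" by auto
  then show ?case using insert by (simp add: algebra_simps)
qed

text \<open>The average is the moment generating function of a Bernoulli variable whose parameter is
  the frequency of \<open>Q\<close>. Both signs of \<open>c\<close> occur below, one for each
  tail.\<close>

lemma average_exp_of_bool_le:
  fixes c :: real
  assumes "n > 0"
  shows "((\<Sum>i<n. exp (c * of_bool (Q i))) / real n) ^ s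
    \<le> exp (real s * ((exp c - 1) * (real (card {i. i < n \<and> Q i}) / real n)))"
proof -
  have "(\<Sum>i<n. exp (c * of_bool (Q i))) / real n
    = 1 + (exp c - 1) * (real (card {i. i < n \<and> Q i}) / real n)"
    using assms by (subst sum_exp_of_bool) (simp_all add: field_simps)
  also have "\<dots> \<le> exp ((exp c - 1) * (real (card {i. i < n \<and> Q i}) / real n))"
    by (rule exp_ge_add_one_self)
  finally have "((\<Sum>i<n. exp (c * of_bool (Q i))) / real n) ^ s
    \<le> exp ((exp c - 1) * (real (card {i. i < n \<and> Q i}) / real n)) ^ s"
    by (intro power_mono) (simp_all add: sum_nonneg)
  then show ?thesis by (simp only: exp_of_nat_mult)
qed

text \<open>
  The acceptance condition of the tester, with \<open>B = prefs X\<close> and \<open>k = |X|! - max_distinct D |X|\<close>: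
  a profile in \<open>D\<close> avoids some class of \<open>k\<close> orders on \<open>X\<close> altogether.
\<close>

definition sparse_class :: "'b set \<Rightarrow> nat \<Rightarrow> real \<Rightarrow> 'b list \<Rightarrow> bool" where
  "sparse_class B k \<theta> rs \<longleftrightarrow> (\<exists>T\<subseteq>B. card T = k \<and> real (length (filter (\<lambda>r. r \<in> T) rs)) \<le> \<theta>)"

text \<open>Rejection makes every class of \<open>k\<close> orders frequent, in particular
  \<open>T\<close>. So the upper tail of a single class suffices, and the index set of the weights
  is a singleton.\<close>

lemma pmf_run_False_le:
  assumes "profile A {..<n} P" "n > 0" "set xs \<subseteq> A" "distinct xs" "length xs \<le> 2 ^ d"
    and "T \<subseteq> B" "card T = k" "c \<ge> 0"
    and few: "real (card {i. i < n \<and> Restr (P i) (set xs) \<in> T}) \<le> \<epsilon> * real n"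
  shows "pmf (run n P (sampler (sparse_class B k \<theta>) d xs s [])) False
    \<le> exp (real s * \<epsilon> * (exp c - 1) - c * \<theta>)"
proof -
  let ?w = "\<lambda>(_::unit) r. exp (c * of_bool (r \<in> T))"
  have "1 \<le> (\<Sum>j\<in>{()}. exp (- c * \<theta>) * (\<Prod>r\<leftarrow>rs. ?w j r))"
    if "sparse_class B k \<theta> rs = False" for rs
  proof -
    have "real (length (filter (\<lambda>r. r \<in> T) rs)) > \<theta>"
    proof (rule ccontr)
      assume "\<not> ?thesis"
      then have "sparse_class B k \<theta> rs"
        using assms(6,7) unfolding sparse_class_def by (intro exI[of _ T]) auto
      with that show False by simp
    qed
    then have "c * \<theta> \<le> c * real (length (filter (\<lambda>r. r \<in> T) rs))"
      using assms(8) by (intro mult_left_mono) auto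
    then show ?thesis
      by (simp add: prod_list_exp_of_bool exp_add[symmetric])
  qed
  from pmf_run_sampler_le[OF assms(1-5) this, where s = s and rs = "[]"]
  have "pmf (run n P (sampler (sparse_class B k \<theta>) d xs s [])) False
    \<le> exp (- c * \<theta>) * ((\<Sum>i<n. exp (c * of_bool (Restr (P i) (set xs) \<in> T))) / real n) ^ s"
    by simp
  also have "\<dots> \<le> exp (- c * \<theta>) * exp (real s * ((exp c - 1) *
      (real (card {i. i < n \<and> Restr (P i) (set xs) \<in> T}) / real n)))"
    by (intro mult_left_mono average_exp_of_bool_le assms(2)) simp
  also have "\<dots> \<le> exp (- c * \<theta>) * exp (real s * ((exp c - 1) * \<epsilon>))"
    using few assms(2,8) by (intro mult_left_mono exp_le_cancel_iff[THEN iffD2]) (auto simp: field_simps)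
  also have "\<dots> = exp (real s * \<epsilon> * (exp c - 1) - c * \<theta>)"
    by (simp add: exp_add[symmetric] algebra_simps)
  finally show ?thesis .
qed

text \<open>Acceptance exhibits some rarely sampled class, whence a union bound over lower
  tails.\<close>

lemma pmf_run_True_le:
  assumes "profile A {..<n} P" "n > 0" "set xs \<subseteq> A" "distinct xs" "length xs \<le> 2 ^ d"
    and "finite B" "c \<ge> 0"
  shows "pmf (run n P (sampler (sparse_class B k \<theta>) d xs s [])) True
    \<le> (\<Sum>T | T \<subseteq> B \<and> card T = k. exp (c * \<theta>) *
        (\<Prod>i<n. exp (- (real s * (1 - exp (- c)) / real n) * of_bool (Restr (P i) (set xs) \<in> T))))"
proof -
  let ?J = "{T. T \<subseteq> B \<and> card T = k}"
  let ?w = "\<lambda>T r. exp (- c * of_bool (r \<in> T))"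
  have finJ: "finite ?J" using assms(6) by simp
  have "1 \<le> (\<Sum>T\<in>?J. exp (c * \<theta>) * (\<Prod>r\<leftarrow>rs. ?w T r))"
    if "sparse_class B k \<theta> rs = True" for rs
  proof -
    obtain T where T: "T \<in> ?J" "real (length (filter (\<lambda>r. r \<in> T) rs)) \<le> \<theta>"
      using \<open>sparse_class B k \<theta> rs = True\<close> unfolding sparse_class_def by blast
    have "c * real (length (filter (\<lambda>r. r \<in> T) rs)) \<le> c * \<theta>"
      using T assms(7) by (intro mult_left_mono) auto
    then have "1 \<le> exp (c * \<theta>) * (\<Prod>r\<leftarrow>rs. ?w T r)"
      unfolding prod_list_exp_of_bool by (simp add: exp_add[symmetric])
    also have "\<dots> \<le> (\<Sum>T\<in>?J. exp (c * \<theta>) * (\<Prod>r\<leftarrow>rs. ?w T r))"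
      using finJ T(1) unfolding prod_list_exp_of_bool by (intro member_le_sum) auto
    finally show ?thesis .
  qed
  from pmf_run_sampler_le[OF assms(1-5) this, where s = s and rs = "[]"]
  have "pmf (run n P (sampler (sparse_class B k \<theta>) d xs s [])) True
    \<le> (\<Sum>T\<in>?J. exp (c * \<theta>) *
        ((\<Sum>i<n. exp (- c * of_bool (Restr (P i) (set xs) \<in> T))) / real n) ^ s)"
    by simp
  also have "\<dots> \<le> (\<Sum>T\<in>?J. exp (c * \<theta>) * exp (real s * ((exp (- c) - 1) *
      (real (card {i. i < n \<and> Restr (P i) (set xs) \<in> T}) / real n))))"
    by (intro sum_mono mult_left_mono average_exp_of_bool_le assms(2)) simp
  \<comment> \<open>The frequency of the class is a sum over agents, so its exponential is a product
    over agents, ready for averaging over independent preferences.\<close>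
  also have "\<dots> = (\<Sum>T\<in>?J. exp (c * \<theta>) *
      (\<Prod>i<n. exp (- (real s * (1 - exp (- c)) / real n) * of_bool (Restr (P i) (set xs) \<in> T))))"
  proof (intro sum.cong refl arg_cong2[where f = "(*)"])
    fix T
    show "exp (real s * ((exp (- c) - 1) *
      (real (card {i. i < n \<and> Restr (P i) (set xs) \<in> T}) / real n))) =
      (\<Prod>i<n. exp (- (real s * (1 - exp (- c)) / real n) * of_bool (Restr (P i) (set xs) \<in> T)))"
      unfolding exp_sum[OF finite_lessThan, symmetric] sum_distrib_left[symmetric]
      by (simp add: Int_def algebra_simps diff_divide_distrib)
  qed
  finally show ?thesis .
qed

text \<open>Independence of the agents turns the expectation into an \<open>n\<close>-th power; each
  factor is computed from the restriction being uniform on \<open>prefs X\<close>.\<close>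

lemma expectation_random_profile:
  assumes "finite A" "X \<subseteq> A" "T \<subseteq> prefs X"
  shows "measure_pmf.expectation (random_profile A n)
      (\<lambda>P. \<Prod>i<n. exp (- \<mu> * of_bool (Restr (P i) X \<in> T)))
    \<le> exp (- (real n * (1 - exp (- \<mu>)) * real (card T) / fact (card X)))"
proof -
  have finX: "finite X" using assms finite_subset by blast
  have setA: "set_pmf (pmf_of_set (prefs A)) = prefs A"
    using finite_prefs[OF assms(1)] prefs_nonempty by (intro set_pmf_of_set)
  let ?e = "measure_pmf.expectation (pmf_of_set (prefs A)) (\<lambda>r. exp (- \<mu> * of_bool (Restr r X \<in> T)))"
  have "?e = measure_pmf.expectation (map_pmf (\<lambda>r. Restr r X) (pmf_of_set (prefs A)))
      (\<lambda>r. exp (- \<mu> * of_bool (r \<in> T)))"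
    by simp
  also have "\<dots> = (\<Sum>r\<in>prefs X. exp (- \<mu> * of_bool (r \<in> T))) / real (card (prefs X))"
    unfolding map_pmf_Restr_prefs[OF assms(1,2)]
    using finite_prefs[OF finX] prefs_nonempty by (intro integral_pmf_of_set)
  also have "\<dots> = 1 + (exp (- \<mu>) - 1) * (real (card T) / fact (card X))"
  proof -
    have "{r \<in> prefs X. r \<in> T} = T" using assms(3) by auto
    then show ?thesis
      using finite_prefs[OF finX] by (subst sum_exp_of_bool) (simp_all add: card_prefs finX field_simps)
  qed
  also have "\<dots> \<le> exp ((exp (- \<mu>) - 1) * (real (card T) / fact (card X)))"
    by (rule exp_ge_add_one_self)
  finally have e: "?e \<le> exp ((exp (- \<mu>) - 1) * (real (card T) / fact (card X)))" .
  have "measure_pmf.expectation (random_profile A n)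
      (\<lambda>P. \<Prod>i<n. exp (- \<mu> * of_bool (Restr (P i) X \<in> T))) = (\<Prod>i<n. ?e)"
    unfolding random_profile_def
    by (rule expectation_prod_Pi_pmf)
      (auto intro!: integrable_measure_pmf_finite simp: setA finite_prefs assms(1) simp del: Int_iff)
  also have "\<dots> = ?e ^ n" by simp
  also have "\<dots> \<le> exp ((exp (- \<mu>) - 1) * (real (card T) / fact (card X))) ^ n"
    by (intro power_mono e integral_nonneg) auto
  also have "\<dots> = exp (- (real n * (1 - exp (- \<mu>)) * real (card T) / fact (card X)))"
    by (simp add: exp_of_nat_mult[symmetric] algebra_simps diff_divide_distrib)
  finally show ?thesis .
qed

lemma finite_set_pmf_random_profile: "finite A \<Longrightarrow> finite (set_pmf (random_profile A n))"
  and profile_random_profile: "finite A \<Longrightarrow> P \<in> set_pmf (random_profile A n) \<Longrightarrow> profile A {..<n} P"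
proof -
  assume A: "finite A"
  have setA: "set_pmf (pmf_of_set (prefs A)) = prefs A"
    using finite_prefs[OF A] prefs_nonempty by (intro set_pmf_of_set)
  show "finite (set_pmf (random_profile A n))"
    unfolding random_profile_def by (auto simp: set_Pi_pmf setA finite_prefs A intro!: finite_PiE_dflt)
  show "P \<in> set_pmf (random_profile A n) \<Longrightarrow> profile A {..<n} P"
    unfolding random_profile_def by (auto simp: set_Pi_pmf setA PiE_dflt_def profile_def)
qed

text \<open>Averages the union bound for fixed profiles. Each agent whose order falls into the class
  contributes \<open>- \<mu>\<close> to the exponent.\<close>

lemma pmf_run_random_profile_le:
  fixes c :: real and s :: nat
  assumes "finite A" "n > 0" "set xs \<subseteq> A" "distinct xs" "length xs \<le> 2 ^ d" "c \<ge> 0"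
  defines "L \<equiv> fact (length xs)" and "\<mu> \<equiv> real s * (1 - exp (- c)) / real n"
  shows "pmf (random_profile A n \<bind>
      (\<lambda>P. run n P (sampler (sparse_class (prefs (set xs)) k \<theta>) d xs s []))) True
    \<le> real (L choose k) * exp (c * \<theta> - real n * (1 - exp (- \<mu>)) * real k / real L)"
proof -
  let ?J = "{T. T \<subseteq> prefs (set xs) \<and> card T = k}"
  have fin: "finite (prefs (set xs))" by (simp add: finite_prefs)
  have L: "card (prefs (set xs)) = L" "fact (card (set xs)) = real L"
    using assms(4) by (simp_all add: card_prefs L_def distinct_card)
  have int: "integrable (measure_pmf (random_profile A n)) f" for f :: "_ \<Rightarrow> real"
    using finite_set_pmf_random_profile[OF assms(1)] by (rule integrable_measure_pmf_finite)
  have "pmf (random_profile A n \<bind>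
      (\<lambda>P. run n P (sampler (sparse_class (prefs (set xs)) k \<theta>) d xs s []))) True
    \<le> measure_pmf.expectation (random_profile A n) (\<lambda>P. \<Sum>T\<in>?J. exp (c * \<theta>) *
        (\<Prod>i<n. exp (- \<mu> * of_bool (Restr (P i) (set xs) \<in> T))))"
    unfolding pmf_bind \<mu>_def
    using pmf_run_True_le[OF profile_random_profile[OF assms(1)] assms(2-5) fin assms(6)]
    by (intro integral_mono_AE int) (auto simp: AE_measure_pmf_iff)
  also have "\<dots> = (\<Sum>T\<in>?J. exp (c * \<theta>) * measure_pmf.expectation (random_profile A n)
        (\<lambda>P. \<Prod>i<n. exp (- \<mu> * of_bool (Restr (P i) (set xs) \<in> T))))"
    by (subst Bochner_Integration.integral_sum) (simp_all add: int)
  also have "\<dots> \<le> (\<Sum>T\<in>?J. exp (c * \<theta>) * exp (- (real n * (1 - exp (- \<mu>)) * real k / real L)))"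
  proof (intro sum_mono mult_left_mono)
    fix T assume "T \<in> ?J"
    then show "measure_pmf.expectation (random_profile A n)
        (\<lambda>P. \<Prod>i<n. exp (- \<mu> * of_bool (Restr (P i) (set xs) \<in> T)))
      \<le> exp (- (real n * (1 - exp (- \<mu>)) * real k / real L))"
      using expectation_random_profile[OF assms(1,3), of T n \<mu>] L by simp
  qed simp
  also have "\<dots> = real (L choose k) * exp (c * \<theta> - real n * (1 - exp (- \<mu>)) * real k / real L)"
    using n_subsets[OF fin, of k] L by (simp add: exp_add[symmetric])
  finally show ?thesis .
qed

subsection \<open>The tester\<close>

text \<open>The exponent for false rejection at \<open>c = \<gamma> / 8\<close>: the terms linear in
  \<open>c\<close> give \<open>- (s * \<rho> * \<gamma>\<^sup>2 / 16)\<close>, and the quadratic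
  error of \<open>exp\<close> costs at most a quarter of this.\<close>

lemma upper_exponent_le:
  fixes s \<rho> \<gamma> :: real
  assumes "0 \<le> s" "0 \<le> \<rho>" "0 < \<gamma>" "\<gamma> \<le> 1"
  shows "s * (\<rho> * (1 - \<gamma>)) * (exp (\<gamma> / 8) - 1) - \<gamma> / 8 * (s * \<rho> * (1 - \<gamma> / 2))
    \<le> - (s * \<rho> * \<gamma>\<^sup>2 / 32)"
proof -
  have "exp (\<gamma> / 8) - 1 \<le> \<gamma> / 8 + (\<gamma> / 8)\<^sup>2"
    using exp_bound[of "\<gamma> / 8"] assms by simp
  then have "s * (\<rho> * (1 - \<gamma>)) * (exp (\<gamma> / 8) - 1) \<le> s * (\<rho> * (1 - \<gamma>)) * (\<gamma> / 8 + (\<gamma> / 8)\<^sup>2)"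
    using assms by (intro mult_left_mono) auto
  moreover have "s * (\<rho> * (1 - \<gamma>)) * (\<gamma> / 8 + (\<gamma> / 8)\<^sup>2) - \<gamma> / 8 * (s * \<rho> * (1 - \<gamma> / 2))
    = - (s * \<rho> * \<gamma>\<^sup>2 / 32) - s * \<rho> * \<gamma>\<^sup>2 * (1 / 64 + \<gamma> / 64)"
    by (simp add: field_simps power2_eq_square)
  moreover have "0 \<le> s * \<rho> * \<gamma>\<^sup>2 * (1 / 64 + \<gamma> / 64)"
    using assms by simp
  ultimately show ?thesis by linarith
qed

text \<open>The exponent for false acceptance. One factor \<open>1 - c\<close> is lost to the tail
  bound for the samples and one to agents being sampled repeatedly; \<open>s \<le> n\<close> yields
  \<open>\<mu> \<le> c\<close> for the latter.\<close>

lemma lower_exponent_le: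
  fixes s \<rho> \<gamma> n :: real
  assumes "0 \<le> s" "0 \<le> \<rho>" "0 < \<gamma>" "\<gamma> \<le> 1" "s \<le> n" "0 < n"
  defines "\<mu> \<equiv> s * (1 - exp (- (\<gamma> / 8))) / n"
  shows "\<gamma> / 8 * (s * \<rho> * (1 - \<gamma> / 2)) - n * (1 - exp (- \<mu>)) * \<rho> \<le> - (s * \<rho> * \<gamma>\<^sup>2 / 32)"
proof -
  define c where "c = \<gamma> / 8"
  have c: "0 < c" "c \<le> 1" using assms by (auto simp: c_def)
  have lo: "c * (1 - c) \<le> 1 - exp (- c)"
    using exp_minus_le_quadratic[of c] c by (simp add: algebra_simps power2_eq_square)
  have hi: "1 - exp (- c) \<le> c" using exp_ge_add_one_self[of "- c"] by simp
  have "\<mu> = s / n * (1 - exp (- c))" by (simp add: \<mu>_def c_def)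
  also have "\<dots> \<le> 1 * c"
    using assms c hi by (intro mult_mono) auto
  finally have \<mu>_le: "\<mu> \<le> c" by simp
  have \<mu>_ge: "0 \<le> \<mu>" using assms c by (simp add: \<mu>_def)
  have n\<mu>: "n * \<mu> = s * (1 - exp (- c))" using assms(6) by (simp add: \<mu>_def c_def)
  have "s * (c * (1 - c)) * (1 - c) \<le> s * (1 - exp (- c)) * (1 - \<mu>)"
    using assms(1) c lo \<mu>_le by (intro mult_mono) (auto intro: order_trans)
  also have "\<dots> = n * (\<mu> * (1 - \<mu>))" by (simp add: n\<mu>[symmetric])
  also have "\<dots> \<le> n * (1 - exp (- \<mu>))"
    using exp_minus_le_quadratic[OF \<mu>_ge] assms(6)
    by (intro mult_left_mono) (auto simp: algebra_simps power2_eq_square)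
  finally have "s * (c * (1 - c)) * (1 - c) * \<rho> \<le> n * (1 - exp (- \<mu>)) * \<rho>"
    using assms(2) by (rule mult_right_mono)
  \<comment> \<open>With \<open>\<gamma> / 2 = 4 * c\<close>, the difference is
    \<open>- 2 * s * \<rho> * c\<^sup>2 - s * \<rho> * c ^ 3\<close>.\<close>
  moreover have "c * (s * \<rho> * (1 - \<gamma> / 2)) - s * (c * (1 - c)) * (1 - c) * \<rho>
    = - (s * \<rho> * \<gamma>\<^sup>2 / 32) - s * \<rho> * c ^ 3"
    by (simp add: c_def field_simps power2_eq_square power3_eq_cube)
  moreover have "0 \<le> s * \<rho> * c ^ 3" using assms c by simp
  ultimately show ?thesis unfolding c_def by linarith
qed

text \<open>Both errors decay like \<open>exp (- (s * \<rho> * \<gamma>\<^sup>2 / 32))\<close>, up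
  to the number of classes for false acceptance. The lower bound on \<open>s\<close> makes this
  exponent pay for the union bound and for \<open>\<delta>\<close>.\<close>

lemma outliers_vs_random_tester_sampler:
  fixes D :: "'a rel set set"
  assumes "normal D" "finite A" "set xs \<subseteq> A" "distinct xs" "xs \<noteq> []" "length xs \<le> 2 ^ d"
    and k: "k + max_distinct D (length xs) = fact (length xs)" "0 < k"
    and \<rho>: "\<rho> = real k / fact (length xs)"
    and \<gamma>: "0 < \<gamma>" "\<gamma> \<le> 1" and \<epsilon>: "\<epsilon> = \<rho> * (1 - \<gamma>)"
    and \<delta>: "0 < \<delta>" "\<delta> < 1"
    and s: "32 * fact (length xs) * (ln (fact (length xs)) + ln (1 / \<delta>)) \<le> real s * \<gamma>\<^sup>2"
    and n: "s \<le> n" "0 < n"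
  shows "outliers_vs_random_tester \<epsilon> \<delta> D A n
    (sampler (sparse_class (prefs (set xs)) k (real s * \<rho> * (1 - \<gamma> / 2))) d xs s [])"
proof -
  define L :: nat where "L = fact (length xs)"
  let ?X = "set xs" and ?\<theta> = "real s * \<rho> * (1 - \<gamma> / 2)"
  let ?t = "sampler (sparse_class (prefs ?X) k ?\<theta>) d xs s []"
  have L: "L \<ge> 1" "real L = fact (length xs)" by (simp_all add: L_def)
  have card_X: "card ?X = length xs" using assms(4) by (rule distinct_card)
  have card_pX: "card (prefs ?X) = L" by (simp add: card_prefs card_X L_def)
  have finpX: "finite (prefs ?X)" by (simp add: finite_prefs)
  have \<rho>0: "0 \<le> \<rho>" "real L * \<rho> = real k" using L by (simp_all add: \<rho>)
  have lnL: "0 \<le> ln (real L)" using L by simp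
  have ln\<delta>: "0 \<le> ln (1 / \<delta>)" using \<delta> by (simp add: ln_div)
  \<comment> \<open>Multiplication by \<open>\<rho>\<close> replaces the factor \<open>L\<close> by
    \<open>k\<close>, matching the exponent \<open>k\<close> in the union bound
    \<open>L ^ k\<close>.\<close>
  have "32 * real L * (ln (real L) + ln (1 / \<delta>)) * \<rho> \<le> real s * \<gamma>\<^sup>2 * \<rho>"
    using s \<rho>0(1) unfolding L(2) by (rule mult_right_mono)
  moreover have "32 * real L * (ln (real L) + ln (1 / \<delta>)) * \<rho>
    = 32 * (real k * (ln (real L) + ln (1 / \<delta>)))"
    unfolding \<rho>0(2)[symmetric] by (simp only: mult_ac)
  moreover have "real s * \<gamma>\<^sup>2 * \<rho> = real s * \<rho> * \<gamma>\<^sup>2" by (simp only: mult_ac)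
  ultimately have big: "real k * (ln (real L) + ln (1 / \<delta>)) \<le> real s * \<rho> * \<gamma>\<^sup>2 / 32"
    by linarith
  have k1: "ln (1 / \<delta>) \<le> real k * ln (1 / \<delta>)"
    using mult_right_mono[of 1 "real k", OF _ ln\<delta>] k(2) by simp
  have exp\<delta>: "exp (- ln (1 / \<delta>)) = \<delta>" using \<delta> by (simp add: ln_div)
  have "pmf (run n P ?t) False \<le> \<delta>"
    if P: "profile A {..<n} P" and out: "has_outliers_at_most \<epsilon> D n P" for P
  proof -
    obtain W where W: "W \<subseteq> {..<n}" "real (card W) \<ge> (1 - \<epsilon>) * real n" "belongs D W P"
      using out unfolding has_outliers_at_most_def by blast
    have finW: "finite W" using W(1) finite_subset by blast
    let ?S = "(\<lambda>i. Restr (P i) ?X) ` W"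
    have "card ?S \<le> max_distinct D (length xs)"
      using card_restrictions_le_max_distinct[OF assms(1-3) _ finW _ W(3)] P W(1) assms(5)
      by (auto simp: card_X profile_def)
    then have "k \<le> card (prefs ?X) - card ?S"
      using k(1) card_pX by (simp add: L_def)
    also have "\<dots> \<le> card (prefs ?X - ?S)"
      using finW by (intro diff_card_le_card_Diff) simp
    \<comment> \<open>No agent in \<open>W\<close> has an order from \<open>T\<close> on
      \<open>X\<close>, so only outliers can fall into \<open>T\<close>.\<close>
    finally obtain T where T: "T \<subseteq> prefs ?X - ?S" "card T = k"
      by (meson obtain_subset_with_card_n)
    have "card {i. i < n \<and> Restr (P i) ?X \<in> T} \<le> card ({..<n} - W)"
      using T(1) by (intro card_mono) auto
    also have "\<dots> = n - card W" using W(1) finW by (simp add: card_Diff_subset)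
    finally have few: "real (card {i. i < n \<and> Restr (P i) ?X \<in> T}) \<le> \<epsilon> * real n"
      using W(2) card_mono[OF _ W(1)] by (simp add: algebra_simps)
    have "pmf (run n P ?t) False \<le> exp (real s * \<epsilon> * (exp (\<gamma> / 8) - 1) - \<gamma> / 8 * ?\<theta>)"
      using T \<gamma> by (intro pmf_run_False_le[OF P n(2) assms(3,4,6) _ T(2) _ few]) auto
    also have "\<dots> \<le> exp (- (real s * \<rho> * \<gamma>\<^sup>2 / 32))"
      using upper_exponent_le[of "real s" \<rho> \<gamma>] \<rho>0 \<gamma> by (simp add: \<epsilon>)
    also have "\<dots> \<le> exp (- ln (1 / \<delta>))"
      using big k1 mult_nonneg_nonneg[OF of_nat_0_le_iff[of k] lnL] unfolding exp_le_cancel_iff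
      by (simp add: distrib_left)
    finally show ?thesis using exp\<delta> by simp
  qed
  moreover have "pmf (random_profile A n \<bind> (\<lambda>P. run n P ?t)) True \<le> \<delta>"
  proof -
    define \<mu> where "\<mu> = real s * (1 - exp (- (\<gamma> / 8))) / real n"
    have "k \<le> L" using k(1) by (simp add: L_def)
    then have "real (L choose k) \<le> real (L ^ k)"
      by (intro of_nat_mono binomial_le_pow)
    also have "\<dots> = exp (real k * ln (real L))"
      using L by (simp add: exp_of_nat_mult)
    finally have choose: "real (L choose k) \<le> exp (real k * ln (real L))" .
    have "pmf (random_profile A n \<bind> (\<lambda>P. run n P ?t)) True
      \<le> real (L choose k) * exp (\<gamma> / 8 * ?\<theta> - real n * (1 - exp (- \<mu>)) * real k / real L)"
      unfolding \<mu>_def L_def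
      using \<gamma> by (intro pmf_run_random_profile_le[OF assms(2) n(2) assms(3,4,6)]) simp
    also have "\<dots> = real (L choose k) * exp (\<gamma> / 8 * ?\<theta> - real n * (1 - exp (- \<mu>)) * \<rho>)"
      by (simp add: \<rho> L)
    also have "\<dots> \<le> exp (real k * ln (real L)) * exp (- (real s * \<rho> * \<gamma>\<^sup>2 / 32))"
      using choose lower_exponent_le[of "real s" \<rho> \<gamma> "real n"] \<rho>0 \<gamma> n
      unfolding \<mu>_def by (intro mult_mono) auto
    also have "\<dots> = exp (real k * ln (real L) - real s * \<rho> * \<gamma>\<^sup>2 / 32)"
      by (simp add: exp_add[symmetric])
    also have "\<dots> \<le> exp (- ln (1 / \<delta>))"
      using big k1 unfolding exp_le_cancel_iff by (simp add: distrib_left)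
    finally show ?thesis using exp\<delta> by simp
  qed
  ultimately show ?thesis
    unfolding outliers_vs_random_tester_def by blast
qed

text \<open>The cost is \<open>s\<close> samples times \<open>l * d\<close> comparisons. One factor
  \<open>l * log 2 l\<close> comes from \<open>ln (fact l)\<close> in the sample size, the other
  from sorting.\<close>

theorem theorem3p6:
  shows "\<exists>C>0. \<forall>(D :: 'a::infinite rel set set) (A :: 'a set) (m :: nat) (\<epsilon> :: real) (\<delta> :: real).
     is_domain D \<and> normal D \<and> neutral D \<and>
     finite A \<and> A \<noteq> {} \<and> card A = m \<and>
     0 \<le> \<epsilon> \<and> \<epsilon> < 1 \<and> residue D m > \<epsilon> \<and> 0 < \<delta> \<and> \<delta> < 1 / 2 \<longrightarrow>
     (let l = min_alternatives D \<epsilon>;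
          q = C * (fact l * (real l)\<^sup>2 * (log 2 (real l))\<^sup>2 / (1 - \<epsilon> / residue D l)\<^sup>2 * ln (1 / \<delta>))
      in \<exists>t :: 'a algorithm. ereal_of_enat (sample_complexity t) \<le> ereal q \<and>
           (\<forall>n. real n \<ge> q \<longrightarrow> outliers_vs_random_tester \<epsilon> \<delta> D A n t))"
proof (intro exI[of _ "130 :: real"] conjI allI impI; (elim conjE)?)
  fix D :: "'a rel set set" and A :: "'a set" and m :: nat and \<epsilon> \<delta> :: real
  assume D: "normal D" and A: "finite A" "A \<noteq> {}" "card A = m"
    and \<epsilon>: "0 \<le> \<epsilon>" "\<epsilon> < 1" "residue D m > \<epsilon>" and \<delta>: "0 < \<delta>" "\<delta> < 1 / 2"
  define l where "l = min_alternatives D \<epsilon>"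
  define \<rho> where "\<rho> = residue D l"
  define \<gamma> where "\<gamma> = 1 - \<epsilon> / \<rho>"
  have m1: "1 \<le> m" using A by (metis One_nat_def Suc_leI card_gt_0_iff)
  have "1 \<le> l \<and> residue D l > \<epsilon>"
    unfolding l_def min_alternatives_def by (rule LeastI[of _ m]) (use m1 \<epsilon>(3) in blast)
  \<comment> \<open>The convention for one alternative excludes \<open>l = 1\<close>, so
    \<open>log 2 (real l)\<close> is at least \<open>1\<close>.\<close>
  moreover have "residue D 1 = 0" by (simp add: residue_def content_def)
  ultimately have l2: "2 \<le> l" and \<rho>\<epsilon>: "\<epsilon> < \<rho>"
    using \<epsilon>(1) unfolding \<rho>_def by (cases "l = 1"; simp)+
  have lm: "l \<le> m"
    unfolding l_def min_alternatives_def by (rule Least_le) (use m1 \<epsilon>(3) in blast)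
  obtain X where X: "X \<subseteq> A" "card X = l"
    using obtain_subset_with_card_n[of l A] lm A(3) by metis
  obtain xs where xs: "set xs = X" "distinct xs"
    using X(1) A(1) finite_distinct_list finite_subset by metis
  have len: "length xs = l" using xs X(2) distinct_card by metis
  define L :: real where "L = fact l"
  define \<Lambda> where "\<Lambda> = real l * log 2 (real l)"
  define \<Delta> where "\<Delta> = ln (1 / \<delta>)"
  define d where "d = nat \<lceil>log 2 (real l)\<rceil>"
  define s where "s = nat \<lceil>32 * L * (ln L + \<Delta>) / \<gamma>\<^sup>2\<rceil>"
  \<comment> \<open>Here \<open>130 = 65 * 2\<close>: the sample size is bounded with
    \<open>64 = 32 * 2\<close> plus \<open>1\<close> for rounding up, and rounding up
    \<open>d\<close> costs another factor \<open>2\<close>.\<close>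
  define q where "q = 130 * (L * \<Lambda>\<^sup>2 / \<gamma>\<^sup>2 * \<Delta>)"
  have log1: "1 \<le> log 2 (real l)" using l2 by (simp add: le_log_iff)
  have L1: "1 \<le> L" by (simp add: L_def)
  have \<Lambda>2: "2 \<le> \<Lambda>"
    using mult_mono[of 2 "real l" 1 "log 2 (real l)"] l2 log1 by (simp add: \<Lambda>_def)
  have \<gamma>: "0 < \<gamma>" "\<gamma> \<le> 1" using \<rho>\<epsilon> \<epsilon>(1) by (simp_all add: \<gamma>_def)
  have "ln 2 \<le> \<Delta>"
    unfolding \<Delta>_def using \<delta> by (subst ln_le_cancel_iff) (auto simp: field_simps)
  then have \<Delta>: "ln 2 \<le> \<Delta>" "1 / 2 \<le> \<Delta>" using ln2_ge_two_thirds by simp_all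
  have \<rho>_eq: "\<rho> = 1 - real (max_distinct D l) / L"
    using l2 by (simp add: \<rho>_def residue_def content_def L_def)
  then have "real (max_distinct D l) / L < 1"
    using \<rho>\<epsilon> \<epsilon>(1) by linarith
  then have "real (max_distinct D l) < real (fact l)"
    by (simp add: L_def)
  then have "max_distinct D l < fact l" by (simp only: of_nat_less_iff)
  then obtain k where k: "k + max_distinct D l = fact l" "0 < k"
    by (metis add.commute less_imp_add_positive)
  have "real k + real (max_distinct D l) = L"
    unfolding L_def using k(1) by (metis of_nat_add of_nat_fact)
  then have \<rho>k: "\<rho> = real k / L"
    using L1 by (simp add: \<rho>_eq field_simps)
  have "real l \<le> 2 ^ d"
  proof -
    have "log 2 (real l) \<le> real d" unfolding d_def by linarith
    then show ?thesis using l2 by (simp add: log_le_iff powr_realpow)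
  qed
  then have ld: "l \<le> 2 ^ d" by (metis of_nat_le_iff of_nat_numeral of_nat_power)
  have d_le: "real d \<le> 2 * log 2 (real l)" unfolding d_def using log1 by linarith
  \<comment> \<open>Since \<open>\<delta> < 1 / 2\<close>, \<open>\<Delta>\<close> is at least
    \<open>ln 2\<close>; this allows the sum \<open>ln L + \<Delta>\<close> to be bounded by a
    product.\<close>
  have lnL: "ln L \<le> \<Lambda> * \<Delta>"
  proof -
    have "L \<le> real (l ^ l)" unfolding L_def by (rule fact_le_power)
    then have "ln L \<le> ln (real (l ^ l))" using L1 by (intro ln_mono) auto
    also have "\<dots> = real l * ln (real l)" using l2 by (simp add: ln_realpow)
    also have "\<dots> = \<Lambda> * ln 2" by (simp add: \<Lambda>_def log_def)
    also have "\<dots> \<le> \<Lambda> * \<Delta>" using \<Lambda>2 \<Delta> by (intro mult_left_mono) auto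
    finally show ?thesis .
  qed
  have "\<Delta> \<le> \<Lambda> * \<Delta>" using mult_right_mono[of 1 \<Lambda> \<Delta>] \<Lambda>2 \<Delta> by simp
  with lnL have "ln L + \<Delta> \<le> 2 * (\<Lambda> * \<Delta>)" by simp
  then have "32 * L * (ln L + \<Delta>) / \<gamma>\<^sup>2 \<le> 32 * L * (2 * (\<Lambda> * \<Delta>)) / \<gamma>\<^sup>2"
    using L1 by (intro divide_right_mono mult_left_mono) auto
  then have "32 * L * (ln L + \<Delta>) / \<gamma>\<^sup>2 \<le> 64 * (L * \<Lambda> * \<Delta> / \<gamma>\<^sup>2)"
    by (simp add: field_simps)
  \<comment> \<open>This absorbs the \<open>1\<close> added by rounding up \<open>s\<close>.\<close>
  moreover have one: "1 \<le> L * \<Lambda> * \<Delta> / \<gamma>\<^sup>2"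
  proof -
    have "1 * 2 * (1 / 2) \<le> L * \<Lambda> * \<Delta>" using L1 \<Lambda>2 \<Delta> by (intro mult_mono) auto
    moreover have "\<gamma>\<^sup>2 \<le> 1" using \<gamma> by (simp add: power_le_one)
    ultimately show ?thesis using \<gamma> by (simp add: le_divide_eq)
  qed
  moreover have s_ge: "32 * L * (ln L + \<Delta>) / \<gamma>\<^sup>2 \<le> real s"
    unfolding s_def by linarith
  moreover have "0 \<le> 32 * L * (ln L + \<Delta>) / \<gamma>\<^sup>2" using L1 \<Delta> by simp
  ultimately have s_le: "real s \<le> 65 * (L * \<Lambda> * \<Delta> / \<gamma>\<^sup>2)"
    unfolding s_def by linarith
  have q_eq: "q = 65 * (L * \<Lambda> * \<Delta> / \<gamma>\<^sup>2) * (2 * \<Lambda>)"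
    by (simp add: q_def power2_eq_square)
  have cost: "real (s * (l * d)) \<le> q"
  proof -
    have "real (l * d) \<le> 2 * \<Lambda>" using mult_left_mono[OF d_le, of "real l"] by (simp add: \<Lambda>_def)
    then have "real s * real (l * d) \<le> 65 * (L * \<Lambda> * \<Delta> / \<gamma>\<^sup>2) * (2 * \<Lambda>)"
      using s_le one by (intro mult_mono) auto
    then show ?thesis by (simp add: q_eq)
  qed
  have sq: "real s \<le> q"
    using mult_mono[OF s_le, of 1 "2 * \<Lambda>"] \<Lambda>2 one by (simp add: q_eq)
  have q0: "0 < q"
    unfolding q_eq using \<Lambda>2 one by (intro mult_pos_pos) linarith+
  let ?t = "sampler (sparse_class (prefs (set xs)) k (real s * \<rho> * (1 - \<gamma> / 2))) d xs s []"
  have "sample_complexity ?t \<le> enat (s * (l * d))"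
    using sample_complexity_sampler[of _ d xs s "[]"] unfolding len .
  then have "ereal_of_enat (sample_complexity ?t) \<le> ereal_of_enat (enat (s * (l * d)))"
    by (simp only: ereal_of_enat_le_iff)
  also have "\<dots> \<le> ereal q" using cost by simp
  finally have complexity: "ereal_of_enat (sample_complexity ?t) \<le> ereal q" .
  have "outliers_vs_random_tester \<epsilon> \<delta> D A n ?t" if "real n \<ge> q" for n
  proof (rule outliers_vs_random_tester_sampler[OF D A(1)])
    show "\<epsilon> = \<rho> * (1 - \<gamma>)" using \<rho>\<epsilon> \<epsilon>(1) by (simp add: \<gamma>_def)
    show "32 * fact (length xs) * (ln (fact (length xs)) + ln (1 / \<delta>)) \<le> real s * \<gamma>\<^sup>2"
      using s_ge \<gamma> by (simp add: len L_def \<Delta>_def divide_le_eq)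
    show "s \<le> n" "0 < n" using sq q0 that by linarith+
  qed (use X xs l2 ld k \<rho>k \<gamma> \<delta> in \<open>auto simp: len L_def\<close>)
  with complexity have "\<exists>t. ereal_of_enat (sample_complexity t) \<le> ereal q \<and>
      (\<forall>n. real n \<ge> q \<longrightarrow> outliers_vs_random_tester \<epsilon> \<delta> D A n t)"
    by blast
  moreover have "q = 130 * (fact l * (real l)\<^sup>2 * (log 2 (real l))\<^sup>2 / (1 - \<epsilon> / residue D l)\<^sup>2 * ln (1 / \<delta>))"
    by (simp add: q_def L_def \<Lambda>_def \<gamma>_def \<rho>_def \<Delta>_def power_mult_distrib mult.assoc)
  ultimately show "let l = min_alternatives D \<epsilon>;
          q = 130 * (fact l * (real l)\<^sup>2 * (log 2 (real l))\<^sup>2 / (1 - \<epsilon> / residue D l)\<^sup>2 * ln (1 / \<delta>))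
      in \<exists>t :: 'a algorithm. ereal_of_enat (sample_complexity t) \<le> ereal q \<and>
           (\<forall>n. real n \<ge> q \<longrightarrow> outliers_vs_random_tester \<epsilon> \<delta> D A n t)"
    unfolding Let_def l_def[symmetric] by simp
qed simp

end
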